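(* Let $M$ be a matroid of rank $k$ on the ground set $E=[n]$, let $r\in[n-k]$, and let $J\subseteq E$. The following are equivalent: (a) $x^J\in I_{\Delta(M)}^{(r)}$. (b) $|J|-\mathrm{rk}_M(J)\ge r$. (c) $\mathrm{rk}_{M^*}(E\setminus J)\le n-k-r$.
   Context: $[m]=\{1,\dots,m\}$. $M^*$ is the dual matroid of $M$, $\mathrm{rk}_M$ and $\mathrm{rk}_{M^*}$ are the rank functions, and $\mathcal{B}(M^* )$ is the set of bases of $M^*$. Let $S=\mathbb{L}[x_1,\dots,x_n]$ be a polynomial ring over a field $\mathbb{L}$; for $U\subseteq E$ put $x^U=\prod_{u\in U}x_u$ and $P_U=\langle x_u: u\in U\rangle$. $\Delta(M)$ is the independence complex of $M$ (its faces are the independent sets) and $I_{\Delta(M)}=\langle x^C: C \text{ a circuit of } M\rangle=\bigcap_{B\in\mathcal{B}(M^* )}P_B$ is its Stanley-Reisner ideal. Its $s$-th symbolic power is $I_{\Delta(M)}^{(s)}=\bigcap_{B\in\mathcal{B}(M^* )}P_B^s$. *)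

theory Defs
  imports "HOL-Algebra.Ideal_Product" "HOL-Library.Poly_Mapping"
begin

section \<open>Matroids\<close>

locale matroid =
  fixes E :: "'e set" and indep :: "'e set \<Rightarrow> bool"
  assumes finite_ground: "finite E"
    and indep_subset_ground: "indep X \<Longrightarrow> X \<subseteq> E"
    and indep_empty: "indep {}"
    and indep_subset: "indep Y \<Longrightarrow> X \<subseteq> Y \<Longrightarrow> indep X"
    and augment: "indep X \<Longrightarrow> indep Y \<Longrightarrow> card X < card Y \<Longrightarrow> \<exists>y\<in>Y - X. indep (insert y X)"

definition bases :: "('e set \<Rightarrow> bool) \<Rightarrow> 'e set set" where
  "bases indep = {B. indep B \<and> (\<forall>A. indep A \<and> B \<subseteq> A \<longrightarrow> A = B)}"

definition circuits :: "'e set \<Rightarrow> ('e set \<Rightarrow> bool) \<Rightarrow> 'e set set" where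
  "circuits E indep = {C. C \<subseteq> E \<and> \<not> indep C \<and> (\<forall>D. D \<subset> C \<longrightarrow> indep D)}"

definition rk :: "('e set \<Rightarrow> bool) \<Rightarrow> 'e set \<Rightarrow> nat" where
  "rk indep X = Max (card ` {A. indep A \<and> A \<subseteq> X})"

definition dual :: "'e set \<Rightarrow> ('e set \<Rightarrow> bool) \<Rightarrow> 'e set \<Rightarrow> bool" where
  "dual E indep A \<longleftrightarrow> (\<exists>B\<in>bases indep. A \<subseteq> E - B)"

lemma (in matroid) bases_dual: "bases (dual E indep) = (\<lambda>B. E - B) ` bases indep"
proof -
  have comp: "B' = B" if "B \<in> bases indep" "B' \<in> bases indep" "E - B \<subseteq> E - B'" for B B'
  proof -
    have "B' \<subseteq> E" using that(2) indep_subset_ground by (auto simp: bases_def)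
    then have "B' \<subseteq> B" using that(3) by auto
    then show ?thesis using that by (auto simp: bases_def)
  qed
  show ?thesis
  proof (intro equalityI subsetI)
    fix A assume A: "A \<in> bases (dual E indep)"
    then obtain B where B: "B \<in> bases indep" "A \<subseteq> E - B" by (auto simp: bases_def dual_def)
    then have "dual E indep (E - B)" by (auto simp: dual_def)
    then have "A = E - B" using A B by (auto simp: bases_def[of "dual E indep"])
    then show "A \<in> (\<lambda>B. E - B) ` bases indep" using B by auto
  next
    fix A assume "A \<in> (\<lambda>B. E - B) ` bases indep"
    then obtain B where B: "B \<in> bases indep" "A = E - B" by auto
    have "C = A" if "dual E indep C" "A \<subseteq> C" for C
    proof -
      from that obtain B' where "B' \<in> bases indep" "C \<subseteq> E - B'" by (auto simp: dual_def)
      with comp[OF B(1), of B'] that B show ?thesis by auto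
    qed
    moreover have "dual E indep A" using B by (auto simp: dual_def)
    ultimately show "A \<in> bases (dual E indep)" by (auto simp: bases_def[of "dual E indep"])
  qed
qed


section \<open>Polynomial rings\<close>

text \<open>Exponent vectors are finitely supported maps \<open>'v \<Rightarrow>\<^sub>0 nat\<close>; the product of
  \<^typ>\<open>('v \<Rightarrow>\<^sub>0 nat) \<Rightarrow>\<^sub>0 'a::field\<close> is convolution. \<open>mpoly_ring V\<close> is \<open>\<bbbL>[x\<^sub>v : v \<in> V]\<close>:
  only the variables indexed by \<open>V\<close> may occur.\<close>

type_synonym ('v, 'a) mpoly = "('v \<Rightarrow>\<^sub>0 nat) \<Rightarrow>\<^sub>0 'a"

definition mpoly_ring :: "'v set \<Rightarrow> ('v, 'a::field) mpoly ring" where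
  "mpoly_ring V =
    \<lparr>carrier = {p. \<forall>m\<in>Poly_Mapping.keys p. Poly_Mapping.keys m \<subseteq> V},
     mult = (*), one = 1, zero = 0, add = (+)\<rparr>"

definition mvar :: "'v \<Rightarrow> ('v, 'a::field) mpoly" where
  "mvar v = Poly_Mapping.single (Poly_Mapping.single v 1) 1"

definition xpow :: "'v set \<Rightarrow> ('v, 'a::field) mpoly" where
  "xpow U = (\<Prod>u\<in>U. mvar u)"

definition var_ideal :: "'v set \<Rightarrow> 'v set \<Rightarrow> ('v, 'a::field) mpoly set" where
  "var_ideal V U = Idl\<^bsub>mpoly_ring V\<^esub> (mvar ` U)"

lemma keys_mpoly_mult:
  fixes p q :: "('v, 'a::field) mpoly"
  assumes "m \<in> Poly_Mapping.keys (p * q)"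
  obtains a b where "a \<in> Poly_Mapping.keys p" "b \<in> Poly_Mapping.keys q" "m = a + b"
  using assms keys_mult[of p q] by auto

lemma keys_exponent_add:
  fixes a b :: "'v \<Rightarrow>\<^sub>0 nat"
  shows "Poly_Mapping.keys (a + b) = Poly_Mapping.keys a \<union> Poly_Mapping.keys b"
  by (auto simp: in_keys_iff lookup_add)

lemma cring_mpoly_ring: "cring (mpoly_ring V :: ('v, 'a::field) mpoly ring)"
proof (rule cringI)
  show "abelian_group (mpoly_ring V :: ('v, 'a) mpoly ring)"
  proof (rule abelian_groupI, goal_cases)
    case (1 x y)
    then show ?case using keys_add[of x y] by (auto simp: mpoly_ring_def)
  next
    case (6 x)
    then show ?case by (intro bexI[of _ "- x"]) (auto simp: mpoly_ring_def)
  qed (simp_all add: mpoly_ring_def add.assoc add.commute)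
  show "Group.comm_monoid (mpoly_ring V :: ('v, 'a) mpoly ring)"
  proof (rule comm_monoidI, goal_cases)
    case (1 x y)
    have "Poly_Mapping.keys m \<subseteq> V" if "m \<in> Poly_Mapping.keys (x * y)" for m
      using that
    proof (rule keys_mpoly_mult)
      fix a b assume "a \<in> Poly_Mapping.keys x" "b \<in> Poly_Mapping.keys y" "m = a + b"
      with 1 show ?thesis by (simp add: mpoly_ring_def keys_exponent_add)
    qed
    then show ?case by (simp add: mpoly_ring_def)
  qed (simp_all add: mpoly_ring_def mult.assoc mult.commute)
qed (simp add: mpoly_ring_def distrib_right)


section \<open>Stanley-Reisner ideals and their symbolic powers\<close>

definition stanley_reisner_ideal ::
    "'e set \<Rightarrow> ('e set \<Rightarrow> bool) \<Rightarrow> ('e, 'a::field) mpoly set" where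
  "stanley_reisner_ideal E indep = Idl\<^bsub>mpoly_ring E\<^esub> (xpow ` circuits E indep)"

text \<open>The power \<open>P\<^sub>B\<^sup>s\<close> is taken in the monoid of ideals under the ideal product.\<close>

definition sr_symbolic_power ::
    "'e set \<Rightarrow> ('e set \<Rightarrow> bool) \<Rightarrow> nat \<Rightarrow> ('e, 'a::field) mpoly set" where
  "sr_symbolic_power E indep s =
    (\<Inter>B\<in>bases (dual E indep). var_ideal E B [^]\<^bsub>ideals_set (mpoly_ring E)\<^esub> s)"

lemma xpow_single:
  assumes "finite U"
  obtains m where "(xpow U :: ('v, 'a::field) mpoly) = Poly_Mapping.single m 1"
    "\<And>v. Poly_Mapping.lookup m v = (if v \<in> U then 1 else 0)"
proof -
  have "\<exists>m. (xpow U :: ('v, 'a) mpoly) = Poly_Mapping.single m 1 \<and>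
      (\<forall>v. Poly_Mapping.lookup m v = (if v \<in> U then 1 else 0))"
    using assms
  proof (induction U rule: finite_induct)
    case empty
    show ?case by (intro exI[of _ 0]) (simp add: xpow_def)
  next
    case (insert u U)
    then obtain m where m: "(xpow U :: ('v, 'a) mpoly) = Poly_Mapping.single m 1"
      "\<forall>v. Poly_Mapping.lookup m v = (if v \<in> U then 1 else 0)" by auto
    have "(xpow (insert u U) :: ('v, 'a) mpoly) = mvar u * xpow U"
      using insert by (simp add: xpow_def)
    also have "\<dots> = Poly_Mapping.single (Poly_Mapping.single u 1 + m) 1"
      by (simp add: m(1) mvar_def mult_single)
    finally show ?case using m(2) insert(2)
      by (intro exI[of _ "Poly_Mapping.single u 1 + m"])
         (auto simp: lookup_add lookup_single when_def)
  qed
  then show ?thesis using that by blast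
qed

lemma genideal_xpow:
  fixes V :: "'v set"
  assumes V: "finite V" and U: "\<And>U. U \<in> \<U> \<Longrightarrow> U \<subseteq> V"
  shows "Idl\<^bsub>mpoly_ring V\<^esub> (xpow ` \<U>) = {p \<in> carrier (mpoly_ring V :: ('v, 'a::field) mpoly ring).
      \<forall>m\<in>Poly_Mapping.keys p. \<exists>U\<in>\<U>. U \<subseteq> Poly_Mapping.keys m}" (is "_ = ?I")
proof -
  let ?R = "mpoly_ring V :: ('v, 'a) mpoly ring"
  interpret R: cring ?R by (rule cring_mpoly_ring)
  have x: "xpow U \<in> ?I" if "U \<in> \<U>" for U
  proof -
    have "finite U" using U[OF that] V finite_subset by blast
    then obtain m where m: "(xpow U :: ('v, 'a) mpoly) = Poly_Mapping.single m 1"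
      "\<And>v. Poly_Mapping.lookup m v = (if v \<in> U then 1 else 0)" using xpow_single by blast
    have "Poly_Mapping.keys m = U" by (auto simp: in_keys_iff m(2) split: if_splits)
    then show ?thesis using that U[OF that] by (auto simp: m(1) mpoly_ring_def)
  qed
  have sub: "xpow ` \<U> \<subseteq> carrier ?R" using x by auto
  interpret J: ideal "Idl\<^bsub>?R\<^esub> (xpow ` \<U>)" ?R by (rule R.genideal_ideal[OF sub])
  have keysm: "\<exists>U\<in>\<U>. U \<subseteq> Poly_Mapping.keys m"
    if "m \<in> Poly_Mapping.keys (p * q)" "p \<in> ?I \<or> q \<in> ?I" for m and p q :: "('v, 'a) mpoly"
    using that(1)
  proof (rule keys_mpoly_mult)
    fix a b assume ab: "a \<in> Poly_Mapping.keys p" "b \<in> Poly_Mapping.keys q" "m = a + b"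
    then have "\<exists>U\<in>\<U>. U \<subseteq> Poly_Mapping.keys a \<or> U \<subseteq> Poly_Mapping.keys b"
      using that(2) by blast
    then show ?thesis unfolding ab(3) keys_exponent_add by blast
  qed
  have inv_eq: "inv\<^bsub>add_monoid ?R\<^esub> a = - a" if "a \<in> carrier ?R" for a
  proof -
    have "\<ominus>\<^bsub>?R\<^esub> a = - a"
      using that by (intro R.minus_equality) (auto simp: mpoly_ring_def)
    then show ?thesis by (simp add: a_inv_def)
  qed
  have "ideal ?I ?R"
  proof (rule idealI)
    show "ring ?R" by (rule R.ring_axioms)
    show "subgroup ?I (add_monoid ?R)"
    proof (rule R.add.subgroupI, goal_cases)
      case 2
      have "0 \<in> ?I" by (simp add: mpoly_ring_def)
      then show ?case by blast
    next
      case (3 a)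
      then have "inv\<^bsub>add_monoid ?R\<^esub> a = - a" using inv_eq by blast
      then show ?case using 3 by (auto simp: mpoly_ring_def a_inv_def)
    next
      case (4 a b)
      then have "a + b \<in> carrier ?R" using R.a_closed[of a b] by (simp add: mpoly_ring_def)
      then show ?case using 4 keys_add[of a b] by (auto simp: mpoly_ring_def)
    qed auto
    fix a b assume ab: "a \<in> ?I" "b \<in> carrier ?R"
    have "a * b \<in> carrier ?R" using ab R.m_closed[of a b] by (simp add: mpoly_ring_def)
    then have "a * b \<in> ?I" using keysm[of _ a b] ab(1) by blast
    then show "a \<otimes>\<^bsub>?R\<^esub> b \<in> ?I" "b \<otimes>\<^bsub>?R\<^esub> a \<in> ?I" by (simp_all add: mpoly_ring_def mult.commute)
  qed
  then have "Idl\<^bsub>?R\<^esub> (xpow ` \<U>) \<subseteq> ?I" using x by (intro R.genideal_minimal) auto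
  moreover have "p \<in> Idl\<^bsub>?R\<^esub> (xpow ` \<U>)" if p: "p \<in> ?I" for p
  proof -
    have mono: "Poly_Mapping.single m (Poly_Mapping.lookup p m) \<in> Idl\<^bsub>?R\<^esub> (xpow ` \<U>)"
      if m: "m \<in> Poly_Mapping.keys p" for m
    proof -
      from p m obtain W where W: "W \<in> \<U>" "W \<subseteq> Poly_Mapping.keys m" by auto
      have "finite W" using U[OF W(1)] V finite_subset by blast
      then obtain w where w: "(xpow W :: ('v, 'a) mpoly) = Poly_Mapping.single w 1"
        "\<And>v. Poly_Mapping.lookup w v = (if v \<in> W then 1 else 0)" using xpow_single by blast
      have eq: "m = (m - w) + w"
      proof (rule poly_mapping_eqI)
        fix v
        show "Poly_Mapping.lookup m v = Poly_Mapping.lookup (m - w + w) v"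
          using W(2) by (cases "v \<in> W") (auto simp: lookup_add lookup_minus w(2) in_keys_iff)
      qed
      let ?q = "Poly_Mapping.single (m - w) (Poly_Mapping.lookup p m)"
      have "Poly_Mapping.keys (m - w) \<subseteq> Poly_Mapping.keys m"
        by (auto simp: in_keys_iff lookup_minus)
      moreover have "Poly_Mapping.keys m \<subseteq> V" using p m by (auto simp: mpoly_ring_def)
      ultimately have "?q \<in> carrier ?R" by (auto simp: mpoly_ring_def split: if_splits)
      moreover have "xpow W \<in> Idl\<^bsub>?R\<^esub> (xpow ` \<U>)" using R.genideal_self[OF sub] W(1) by blast
      ultimately have "?q \<otimes>\<^bsub>?R\<^esub> xpow W \<in> Idl\<^bsub>?R\<^esub> (xpow ` \<U>)" by (intro J.I_l_closed)
      then show ?thesis by (simp add: mpoly_ring_def w(1) mult_single eq[symmetric])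
    qed
    have add: "a + b \<in> Idl\<^bsub>?R\<^esub> (xpow ` \<U>)"
      if "a \<in> Idl\<^bsub>?R\<^esub> (xpow ` \<U>)" "b \<in> Idl\<^bsub>?R\<^esub> (xpow ` \<U>)" for a b
      using J.a_closed[OF that] by (simp add: mpoly_ring_def)
    have zero: "0 \<in> Idl\<^bsub>?R\<^esub> (xpow ` \<U>)" using J.zero_closed by (simp add: mpoly_ring_def)
    have "(\<Sum>m\<in>K. Poly_Mapping.single m (Poly_Mapping.lookup p m)) \<in> Idl\<^bsub>?R\<^esub> (xpow ` \<U>)"
      if "finite K" "K \<subseteq> Poly_Mapping.keys p" for K
      using that by (induction K rule: finite_induct) (auto intro: add zero mono)
    moreover have "(\<Sum>m\<in>Poly_Mapping.keys p. Poly_Mapping.single m (Poly_Mapping.lookup p m)) = p"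
    proof (rule poly_mapping_eqI)
      fix a
      show "Poly_Mapping.lookup (\<Sum>m\<in>Poly_Mapping.keys p.
          Poly_Mapping.single m (Poly_Mapping.lookup p m)) a = Poly_Mapping.lookup p a"
        by (simp add: lookup_sum lookup_single when_def in_keys_iff)
    qed
    ultimately show ?thesis by (metis finite_keys order_refl)
  qed
  ultimately show ?thesis by blast
qed

lemma (in matroid) indep_subset_basis:
  assumes "indep X" obtains B where "B \<in> bases indep" "X \<subseteq> B"
proof -
  have "finite {A. indep A}"
    using finite_ground indep_subset_ground by (intro finite_subset[of "{A. indep A}" "Pow E"]) blast+
  then obtain B where B: "B \<in> {A. indep A}" "X \<subseteq> B" "\<forall>A\<in>{A. indep A}. B \<subseteq> A \<longrightarrow> B = A"
    using finite_has_maximal2[of "{A. indep A}" X] assms by blast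
  then have "B \<in> bases indep" unfolding bases_def by blast
  then show ?thesis using B(2) that by blast
qed

lemma (in matroid) dependent_superset_circuit:
  assumes "\<not> indep X" "X \<subseteq> E" obtains C where "C \<in> circuits E indep" "C \<subseteq> X"
proof -
  have "finite {A. A \<subseteq> E \<and> \<not> indep A}" using finite_ground by simp
  then obtain C where C: "C \<in> {A. A \<subseteq> E \<and> \<not> indep A}" "C \<subseteq> X"
      "\<forall>A\<in>{A. A \<subseteq> E \<and> \<not> indep A}. A \<subseteq> C \<longrightarrow> C = A"
    using finite_has_minimal2[of "{A. A \<subseteq> E \<and> \<not> indep A}" X] assms by blast
  then have "C \<in> circuits E indep" unfolding circuits_def by blast
  then show ?thesis using C(2) that by blast
qed

theorem (in matroid) stanley_reisner_ideal_eq: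
  "(stanley_reisner_ideal E indep :: ('e, 'b::field) mpoly set) = (\<Inter>B\<in>bases (dual E indep). var_ideal E B)"
  (is "?L = (\<Inter>B\<in>?D. _)")
proof -
  let ?R = "mpoly_ring E :: ('e, 'b::field) mpoly ring"
  have L: "?L = {p \<in> carrier ?R. \<forall>m\<in>Poly_Mapping.keys p. \<exists>U\<in>circuits E indep. U \<subseteq> Poly_Mapping.keys m}"
    unfolding stanley_reisner_ideal_def
    using finite_ground by (intro genideal_xpow) (auto simp: circuits_def)
  have P: "(var_ideal E B :: ('e, 'b::field) mpoly set) =
      {p \<in> carrier ?R. \<forall>m\<in>Poly_Mapping.keys p. B \<inter> Poly_Mapping.keys m \<noteq> {}}"
    if "B \<in> ?D" for B
  proof -
    have "B \<subseteq> E" using that unfolding bases_dual by auto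
    then have "Idl\<^bsub>?R\<^esub> (xpow ` (\<lambda>b. {b}) ` B) = {p \<in> carrier ?R.
        \<forall>m\<in>Poly_Mapping.keys p. \<exists>U\<in>(\<lambda>b. {b}) ` B. U \<subseteq> Poly_Mapping.keys m}"
      using finite_ground by (intro genideal_xpow) auto
    moreover have "xpow ` (\<lambda>b. {b}) ` B = (mvar ` B :: ('e, 'b::field) mpoly set)"
      by (simp add: image_image xpow_def)
    ultimately show ?thesis by (auto simp: var_ideal_def)
  qed
  have iff: "(\<exists>U\<in>circuits E indep. U \<subseteq> X) \<longleftrightarrow> (\<forall>B\<in>?D. B \<inter> X \<noteq> {})" if "X \<subseteq> E" for X
  proof -
    have "(\<exists>U\<in>circuits E indep. U \<subseteq> X) \<longleftrightarrow> \<not> indep X"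
    proof
      assume "\<exists>U\<in>circuits E indep. U \<subseteq> X"
      then show "\<not> indep X" using indep_subset unfolding circuits_def by blast
    next
      assume "\<not> indep X"
      then show "\<exists>U\<in>circuits E indep. U \<subseteq> X"
        using dependent_superset_circuit[OF _ that] by metis
    qed
    also have "indep X \<longleftrightarrow> (\<exists>B\<in>bases indep. X \<subseteq> B)"
    proof
      assume "indep X"
      then show "\<exists>B\<in>bases indep. X \<subseteq> B" using indep_subset_basis[of X] by metis
    next
      assume "\<exists>B\<in>bases indep. X \<subseteq> B"
      then show "indep X" using indep_subset unfolding bases_def by blast
    qed
    also have "\<dots> \<longleftrightarrow> (\<exists>B\<in>?D. B \<inter> X = {})" unfolding bases_dual using that by auto
    finally show ?thesis by blast
  qed
  obtain B0 where "B0 \<in> bases indep" using indep_subset_basis[OF indep_empty] .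
  then have "E - B0 \<in> ?D" unfolding bases_dual by blast
  then have ne: "?D \<noteq> {}" by blast
  have "(\<Inter>B\<in>?D. var_ideal E B) = (\<Inter>B\<in>?D. {p \<in> carrier ?R.
      \<forall>m\<in>Poly_Mapping.keys p. B \<inter> Poly_Mapping.keys m \<noteq> {}})"
    using P by (rule INF_cong[OF refl])
  also have "\<dots> = {p \<in> carrier ?R.
      \<forall>m\<in>Poly_Mapping.keys p. \<forall>B\<in>?D. B \<inter> Poly_Mapping.keys m \<noteq> {}}"
    using ne by blast
  also have "\<dots> = ?L"
    unfolding L
  proof (rule Collect_cong, rule conj_cong[OF refl], rule ball_cong[OF refl])
    fix p :: "('e, 'b) mpoly" and m
    assume "p \<in> carrier ?R" "m \<in> Poly_Mapping.keys p"
    then have "Poly_Mapping.keys m \<subseteq> E" by (simp add: mpoly_ring_def)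
    from iff[OF this] show "(\<forall>B\<in>?D. B \<inter> Poly_Mapping.keys m \<noteq> {}) \<longleftrightarrow>
        (\<exists>U\<in>circuits E indep. U \<subseteq> Poly_Mapping.keys m)" by (rule sym)
  qed
  finally show ?thesis by simp
qed

end

theory Submission
  imports Defs
begin

text \<open>A monomial lies in \<open>P\<^sub>U\<^sup>s\<close> iff its degree in the variables of \<open>U\<close> is at least \<open>s\<close>.
  Since the bases of the dual matroid are the complements of the bases \<open>B\<close> of \<open>M\<close>, (a) says
  that \<open>\<bar>J - B\<bar> \<ge> r\<close> for all \<open>B\<close>, and the largest value of \<open>\<bar>J \<inter> B\<bar>\<close> is \<open>rk\<^sub>M J\<close>.
  The same maximum appears in \<open>rk\<^bsub>M*\<^esub> (E - J)\<close>, the largest value of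
  \<open>\<bar>E - (B \<union> J)\<bar> = \<bar>E\<bar> - \<bar>J\<bar> - k + \<bar>J \<inter> B\<bar>\<close>.\<close>

lemma xpow_in_carrier:
  assumes "finite J" "J \<subseteq> V"
  shows "(xpow J :: ('v, 'a::field) mpoly) \<in> carrier (mpoly_ring V)"
proof -
  obtain m where m: "(xpow J :: ('v, 'a) mpoly) = Poly_Mapping.single m 1"
    "\<And>v. Poly_Mapping.lookup m v = (if v \<in> J then 1 else 0)"
    using xpow_single[OF assms(1)] by blast
  have "Poly_Mapping.keys m \<subseteq> V"
    using assms(2) by (auto simp: in_keys_iff m(2) split: if_splits)
  then show ?thesis by (simp add: m(1) mpoly_ring_def)
qed

lemma mvar_in_carrier:
  assumes "v \<in> V"
  shows "(mvar v :: ('v, 'a::field) mpoly) \<in> carrier (mpoly_ring V)"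
  using assms by (simp add: mvar_def mpoly_ring_def)

definition deg_in :: "'v set \<Rightarrow> ('v \<Rightarrow>\<^sub>0 nat) \<Rightarrow> nat" where
  "deg_in U m = (\<Sum>u\<in>U. Poly_Mapping.lookup m u)"

lemma deg_in_add: "deg_in U (a + b) = deg_in U a + deg_in U b"
  by (simp add: deg_in_def lookup_add sum.distrib)

text \<open>Each \<open>mvar u\<close> is \<open>xpow {u}\<close>, so \<open>genideal_xpow\<close>,
  applied to the singletons of \<open>U\<close>, shows that every monomial of a member contains a
  variable of \<open>U\<close>.\<close>

lemma var_ideal_deg_in:
  assumes V: "finite V" and U: "U \<subseteq> V"
    and p: "(p :: ('v, 'a::field) mpoly) \<in> var_ideal V U" and m: "m \<in> Poly_Mapping.keys p"
  shows "1 \<le> deg_in U m"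
proof -
  have "xpow ` (\<lambda>u. {u}) ` U = (mvar ` U :: ('v, 'a) mpoly set)"
    by (simp add: image_image xpow_def)
  then have "p \<in> Idl\<^bsub>mpoly_ring V\<^esub> (xpow ` (\<lambda>u. {u}) ` U)"
    using p by (simp add: var_ideal_def)
  also have "\<dots> = {p \<in> carrier (mpoly_ring V).
      \<forall>m\<in>Poly_Mapping.keys p. \<exists>W\<in>(\<lambda>u. {u}) ` U. W \<subseteq> Poly_Mapping.keys m}"
    using V U by (intro genideal_xpow) auto
  finally obtain u where u: "u \<in> U" "u \<in> Poly_Mapping.keys m" using m by auto
  have "finite U" using V U finite_subset by blast
  then have "Poly_Mapping.lookup m u \<le> deg_in U m"
    unfolding deg_in_def using u(1) by (intro member_le_sum) auto
  moreover have "1 \<le> Poly_Mapping.lookup m u" using u(2) by (simp add: in_keys_iff Suc_le_eq)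
  ultimately show ?thesis by linarith
qed

text \<open>Degrees in \<open>U\<close> add up under products, and a sum has no monomials beyond
  those of its summands. The claim concerns all monomials of an arbitrary member because the factors
  arising in the induction need not be monomials.\<close>

lemma var_ideal_power_deg_in:
  assumes V: "finite V" and U: "U \<subseteq> V"
    and "(p :: ('v, 'a::field) mpoly) \<in> var_ideal V U [^]\<^bsub>ideals_set (mpoly_ring V)\<^esub> (s::nat)"
    and "m \<in> Poly_Mapping.keys p"
  shows "s \<le> deg_in U m"
  using assms(3,4)
proof (induction s arbitrary: p m)
  case 0
  then show ?case by simp
next
  case (Suc s)
  let ?R = "mpoly_ring V :: ('v, 'a) mpoly ring"
  let ?I = "var_ideal V U [^]\<^bsub>ideals_set ?R\<^esub> s"
  have "p \<in> ?I \<cdot>\<^bsub>?R\<^esub> var_ideal V U" using Suc.prems(1) by (simp add: ideals_set_def nat_pow_def)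
  \<comment> \<open>Inner induction over the generation of the ideal product: products of members
    first, then sums of elements already generated.\<close>
  then have "\<forall>m\<in>Poly_Mapping.keys p. Suc s \<le> deg_in U m"
  proof (induction rule: ideal_prod.induct)
    case (prod i j)
    show ?case
    proof
      fix m assume "m \<in> Poly_Mapping.keys (i \<otimes>\<^bsub>?R\<^esub> j)"
      then have "m \<in> Poly_Mapping.keys (i * j)" by (simp add: mpoly_ring_def)
      then obtain a b where ab: "a \<in> Poly_Mapping.keys i" "b \<in> Poly_Mapping.keys j" "m = a + b"
        by (rule keys_mpoly_mult)
      have "s \<le> deg_in U a" using prod(1) ab(1) by (rule Suc.IH)
      moreover have "1 \<le> deg_in U b" using V U prod(2) ab(2) by (rule var_ideal_deg_in)
      ultimately show "Suc s \<le> deg_in U m" by (simp add: ab(3) deg_in_add)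
    qed
  next
    case (sum s1 s2)
    then show ?case using keys_add[of s1 s2] by (auto simp: mpoly_ring_def)
  qed
  then show ?case using Suc.prems(2) by blast
qed

text \<open>Each variable in \<open>J \<inter> U\<close> supplies one factor from the ideal.
  Splitting off such a \<open>u\<close> leaves \<open>xpow (J - {u})\<close>, so \<open>J\<close>
  has to vary in the induction.\<close>

lemma xpow_in_var_ideal_power:
  assumes V: "finite V" and U: "U \<subseteq> V" and "J \<subseteq> V" "s \<le> card (J \<inter> U)"
  shows "(xpow J :: ('v, 'a::field) mpoly) \<in> var_ideal V U [^]\<^bsub>ideals_set (mpoly_ring V)\<^esub> s"
  using assms(3,4)
proof (induction s arbitrary: J)
  case 0
  then have "(xpow J :: ('v, 'a) mpoly) \<in> carrier (mpoly_ring V)"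
    using V finite_subset by (intro xpow_in_carrier) auto
  \<comment> \<open>The zeroth power is the unit of the monoid of ideals, that is, the whole
    ring.\<close>
  then show ?case by (simp add: ideals_set_def nat_pow_def)
next
  case (Suc s)
  let ?R = "mpoly_ring V :: ('v, 'a) mpoly ring"
  interpret R: cring ?R by (rule cring_mpoly_ring)
  have fin: "finite J" using Suc.prems(1) V finite_subset by blast
  have "J \<inter> U \<noteq> {}" using Suc.prems(2) by auto
  then obtain u where u: "u \<in> J" "u \<in> U" by blast
  have "(J - {u}) \<inter> U = (J \<inter> U) - {u}" by auto
  then have "s \<le> card ((J - {u}) \<inter> U)" using Suc.prems(2) u fin by simp
  then have *: "(xpow (J - {u}) :: ('v, 'a) mpoly) \<in> var_ideal V U [^]\<^bsub>ideals_set ?R\<^esub> s"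
    using Suc.prems(1) by (intro Suc.IH) auto
  have "(mvar u :: ('v, 'a) mpoly) \<in> var_ideal V U"
    unfolding var_ideal_def
  proof (rule subsetD[OF R.genideal_self])
    show "(mvar ` U :: ('v, 'a) mpoly set) \<subseteq> carrier ?R"
      using U by (intro image_subsetI mvar_in_carrier) (rule subsetD)
    show "mvar u \<in> mvar ` U" using u(2) by (rule imageI)
  qed
  with * have "xpow (J - {u}) \<otimes>\<^bsub>?R\<^esub> mvar u \<in>
      (var_ideal V U [^]\<^bsub>ideals_set ?R\<^esub> s) \<cdot>\<^bsub>?R\<^esub> var_ideal V U"
    by (rule ideal_prod.prod)
  moreover have "xpow (J - {u}) \<otimes>\<^bsub>?R\<^esub> mvar u = xpow J"
    unfolding xpow_def prod.remove[OF fin u(1)] by (simp add: mpoly_ring_def mult.commute)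
  ultimately show ?case by (simp add: ideals_set_def nat_pow_def)
qed

lemma xpow_in_var_ideal_power_iff:
  assumes V: "finite V" and U: "U \<subseteq> V" and J: "J \<subseteq> V"
  shows "(xpow J :: ('v, 'a::field) mpoly) \<in> var_ideal V U [^]\<^bsub>ideals_set (mpoly_ring V)\<^esub> s
    \<longleftrightarrow> s \<le> card (J \<inter> U)"
proof
  assume x: "(xpow J :: ('v, 'a) mpoly) \<in> var_ideal V U [^]\<^bsub>ideals_set (mpoly_ring V)\<^esub> s"
  have "finite J" "finite U" using V U J finite_subset by blast+
  then obtain m where m: "(xpow J :: ('v, 'a) mpoly) = Poly_Mapping.single m 1"
    "\<And>v. Poly_Mapping.lookup m v = (if v \<in> J then 1 else 0)"
    using xpow_single by blast
  have "s \<le> deg_in U m" using V U x by (rule var_ideal_power_deg_in) (simp add: m(1))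
  \<comment> \<open>The exponent \<open>m\<close> is the indicator function of \<open>J\<close>, so
    its sum over \<open>U\<close> counts \<open>J \<inter> U\<close>.\<close>
  also have "deg_in U m = card (J \<inter> U)"
    using \<open>finite U\<close> by (simp add: deg_in_def m(2) sum.If_cases Int_commute)
  finally show "s \<le> card (J \<inter> U)" .
qed (use assms in \<open>auto intro: xpow_in_var_ideal_power\<close>)

context matroid
begin

lemma finite_indep: "finite {A. indep A \<and> A \<subseteq> X}"
  using finite_ground indep_subset_ground
  by (intro finite_subset[of "{A. indep A \<and> A \<subseteq> X}" "Pow E"]) blast+

lemma card_le_rk:
  assumes "indep A" "A \<subseteq> X"
  shows "card A \<le> rk indep X"
  unfolding rk_def using assms finite_indep[of X] by (intro Max_ge) auto

lemma rk_attained: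
  obtains A where "indep A" "A \<subseteq> X" "card A = rk indep X"
proof -
  have "rk indep X \<in> card ` {A. indep A \<and> A \<subseteq> X}"
    unfolding rk_def using finite_indep[of X] indep_empty by (intro Max_in) auto
  then show ?thesis using that by auto
qed

lemma bases_subset_ground: "B \<in> bases indep \<Longrightarrow> B \<subseteq> E"
  using indep_subset_ground by (auto simp: bases_def)

lemma finite_indep_set: "indep A \<Longrightarrow> finite A"
  using indep_subset_ground finite_ground finite_subset by blast

text \<open>A basis smaller than some independent set could be augmented, against its
  maximality.\<close>

lemma card_basis:
  assumes "B \<in> bases indep"
  shows "card B = rk indep E"
proof (rule antisym)
  have B: "indep B" using assms by (simp add: bases_def)
  show "card B \<le> rk indep E" using B indep_subset_ground by (intro card_le_rk) auto
  show "rk indep E \<le> card B"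
  proof (rule ccontr)
    assume "\<not> rk indep E \<le> card B"
    moreover obtain A where "indep A" "card A = rk indep E" using rk_attained by metis
    ultimately obtain y where "y \<in> A - B" "indep (insert y B)" using augment[OF B] by fastforce
    then show False using assms by (auto simp: bases_def)
  qed
qed

lemma card_Int_basis_le_rk:
  assumes "B \<in> bases indep"
  shows "card (J \<inter> B) \<le> rk indep J"
proof (rule card_le_rk)
  show "indep (J \<inter> B)" using assms indep_subset[of B "J \<inter> B"] by (auto simp: bases_def)
qed auto

text \<open>Extend a largest independent subset of \<open>J\<close> to a basis; its trace on
  \<open>J\<close> is independent, hence no larger than that subset.\<close>

lemma basis_attaining_rk:
  obtains B where "B \<in> bases indep" "card (J \<inter> B) = rk indep J"
proof -
  obtain A where A: "indep A" "A \<subseteq> J" "card A = rk indep J" using rk_attained .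
  obtain B where B: "B \<in> bases indep" "A \<subseteq> B" using indep_subset_basis[OF A(1)] .
  have "finite (J \<inter> B)" using B(1) finite_indep_set by (auto simp: bases_def)
  then have "card A \<le> card (J \<inter> B)" using A B by (intro card_mono) auto
  then show ?thesis using card_Int_basis_le_rk[OF B(1), of J] A(3) B(1) that by simp
qed

text \<open>The minimum of \<open>card (J - B)\<close> is reached where
  \<open>card (J \<inter> B)\<close> is largest. The additive form avoids truncated
  subtraction.\<close>

lemma le_card_Diff_bases_iff:
  assumes "J \<subseteq> E"
  shows "(\<forall>B\<in>bases indep. s \<le> card (J - B)) \<longleftrightarrow> s + rk indep J \<le> card J"
proof -
  have "finite J" using assms finite_ground finite_subset by blast
  then have split: "card J = card (J \<inter> B) + card (J - B)" for B
    by (rule card_Int_Diff)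
  obtain B0 where B0: "B0 \<in> bases indep" "card (J \<inter> B0) = rk indep J" using basis_attaining_rk .
  show ?thesis
  proof
    assume "\<forall>B\<in>bases indep. s \<le> card (J - B)"
    then have "s \<le> card (J - B0)" using B0(1) by blast
    then show "s + rk indep J \<le> card J" using split[of B0] B0(2) by simp
  next
    assume s: "s + rk indep J \<le> card J"
    show "\<forall>B\<in>bases indep. s \<le> card (J - B)"
    proof
      fix B assume "B \<in> bases indep"
      from card_Int_basis_le_rk[OF this, of J] show "s \<le> card (J - B)"
        using split[of B] s by simp
    qed
  qed
qed

text \<open>By inclusion-exclusion and equicardinality of bases, \<open>card (E - J - B)\<close> and
  \<open>card (J \<inter> B)\<close> differ by an amount independent of \<open>B\<close>, so the
  same bases maximize both.\<close>

lemma card_Diff_basis_Un: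
  assumes J: "J \<subseteq> E" and B: "B \<in> bases indep"
  shows "card (E - J - B) + card J + rk indep E = card E + card (J \<inter> B)"
proof -
  have BE: "B \<subseteq> E" using B by (rule bases_subset_ground)
  have fin: "finite J" "finite B" using J BE finite_ground finite_subset by blast+
  have "card (J \<union> B) + card (J \<inter> B) = card J + rk indep E"
    using card_Un_Int[OF fin] card_basis[OF B] by simp
  moreover have "card (E - (J \<union> B)) + card (J \<union> B) = card E"
    using J BE finite_ground fin card_mono[of E "J \<union> B"] by (simp add: card_Diff_subset)
  moreover have "E - (J \<union> B) = E - J - B" by auto
  ultimately show ?thesis by simp
qed

text \<open>This is the classical dual rank formula for the set \<open>E - J\<close>, with all
  subtractions moved across the equation.\<close>

lemma rk_dual:
  assumes J: "J \<subseteq> E"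
  shows "rk (dual E indep) (E - J) + card J + rk indep E = card E + rk indep J"
proof -
  obtain B0 where B0: "B0 \<in> bases indep" "card (J \<inter> B0) = rk indep J" using basis_attaining_rk .
  have "rk (dual E indep) (E - J) = card (E - J - B0)"
    unfolding rk_def
  proof (rule Max_eqI)
    show "finite (card ` {A. dual E indep A \<and> A \<subseteq> E - J})" using finite_ground by simp
    show "card (E - J - B0) \<in> card ` {A. dual E indep A \<and> A \<subseteq> E - J}"
      using B0(1) by (intro imageI) (auto simp: dual_def)
    fix c assume "c \<in> card ` {A. dual E indep A \<and> A \<subseteq> E - J}"
    then obtain A B where A: "c = card A" "B \<in> bases indep" "A \<subseteq> E - B" "A \<subseteq> E - J"
      by (auto simp: dual_def)
    \<comment> \<open>A dual-independent set avoids some basis \<open>B\<close>, which confines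
      \<open>A\<close> to \<open>E - J - B\<close>.\<close>
    have "c \<le> card (E - J - B)"
      unfolding A(1) using A(3,4) finite_ground by (intro card_mono) auto
    then show "c \<le> card (E - J - B0)"
      using card_Diff_basis_Un[OF J A(2)] card_Diff_basis_Un[OF J B0(1)]
        card_Int_basis_le_rk[OF A(2), of J] B0(2) by linarith
  qed
  then show ?thesis using card_Diff_basis_Un[OF J B0(1)] B0(2) by simp
qed

lemma xpow_in_sr_symbolic_power_iff:
  assumes J: "J \<subseteq> E"
  shows "(xpow J :: ('e, 'b::field) mpoly) \<in> sr_symbolic_power E indep s
    \<longleftrightarrow> s + rk indep J \<le> card J"
proof -
  have "(xpow J :: ('e, 'b) mpoly) \<in> sr_symbolic_power E indep s
      \<longleftrightarrow> (\<forall>B\<in>bases indep. s \<le> card (J \<inter> (E - B)))"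
    unfolding sr_symbolic_power_def bases_dual
    using xpow_in_var_ideal_power_iff[OF finite_ground Diff_subset J, where 'a='b] by simp
  moreover have "J \<inter> (E - B) = J - B" for B using J by auto
  ultimately show ?thesis using le_card_Diff_bases_iff[OF J] by simp
qed

end

theorem theorem3p1:
  fixes n k r :: nat and indep :: "nat set \<Rightarrow> bool" and J :: "nat set"
  assumes "matroid {1..n} indep"
    and "rk indep {1..n} = k"
    and "r \<in> {1..n - k}"
    and "J \<subseteq> {1..n}"
  shows "((xpow J :: (nat, 'l::field) mpoly) \<in> sr_symbolic_power {1..n} indep r
            \<longleftrightarrow> int (card J) - int (rk indep J) \<ge> int r)
       \<and> (int (card J) - int (rk indep J) \<ge> int r
            \<longleftrightarrow> int (rk (dual {1..n} indep) ({1..n} - J)) \<le> int n - int k - int r)"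
proof -
  interpret matroid "{1..n}" indep by (rule assms(1))
  show ?thesis
    unfolding xpow_in_sr_symbolic_power_iff[OF assms(4), where 'b='l]
    \<comment> \<open>With \<open>card {1..n} = n\<close>, the second equivalence is a rearrangement
      of \<open>rk_dual\<close> over the integers.\<close>
    using rk_dual[OF assms(4)] assms(2) by simp linarith
qed

end
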